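(* Let $X$ be a unicyclic bipartite graph with a unique perfect matching. If $X$ has more than two pegs, then between any two vertices of $X$ there is at most one co-augmenting path.
   Context: A unicyclic graph is a connected graph containing exactly one cycle. Let $\mathcal{M}$ be the unique perfect matching. A peg is an edge of $\mathcal{M}$ that is not an edge of the cycle but is incident to a vertex of the cycle. A path is co-augmenting if its edges alternate between edges of $\mathcal{M}$ and edges not in $\mathcal{M}$, with the first and last edges in $\mathcal{M}$. (The same applies to mixed graphs via their underlying graphs.) *)

theory Defs
  imports Main
begin

text \<open>Graphs are finite, undirected and simple: a vertex set \<open>V\<close> and a set \<open>E\<close> of
  two-element subsets of \<open>V\<close>.\<close>

locale simple_graph =
  fixes V :: "'a set" and E :: "'a set set"
  assumes finite_verts: "finite V"
    and edge_subset: "e \<in> E \<Longrightarrow> e \<subseteq> V"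
    and card_edge: "e \<in> E \<Longrightarrow> card e = 2"

text \<open>A path is given by its nonempty list of pairwise distinct vertices.\<close>

definition is_path :: "'a set \<Rightarrow> 'a set set \<Rightarrow> 'a \<Rightarrow> 'a list \<Rightarrow> 'a \<Rightarrow> bool" where
  "is_path V E u p v \<longleftrightarrow>
     p \<noteq> [] \<and> hd p = u \<and> last p = v \<and> set p \<subseteq> V \<and> distinct p \<and>
     successively (\<lambda>x y. {x, y} \<in> E) p"

definition path_edges :: "'a list \<Rightarrow> 'a set list" where
  "path_edges p = map2 (\<lambda>x y. {x, y}) p (tl p)"

definition connected_graph :: "'a set \<Rightarrow> 'a set set \<Rightarrow> bool" where
  "connected_graph V E \<longleftrightarrow> V \<noteq> {} \<and> (\<forall>u\<in>V. \<forall>v\<in>V. \<exists>p. is_path V E u p v)"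

text \<open>A cycle is identified with its edge set \<open>C\<close>, so that the different starting points and
  orientations of a closed vertex sequence do not count as different cycles; its vertex set
  is \<open>\<Union>C\<close>.\<close>

definition is_cycle :: "'a set \<Rightarrow> 'a set set \<Rightarrow> 'a set set \<Rightarrow> bool" where
  "is_cycle V E C \<longleftrightarrow>
     (\<exists>u p v. is_path V E u p v \<and> 3 \<le> length p \<and> {v, u} \<in> E \<and>
        C = insert {v, u} (set (path_edges p)))"

definition unicyclic :: "'a set \<Rightarrow> 'a set set \<Rightarrow> bool" where
  "unicyclic V E \<longleftrightarrow> connected_graph V E \<and> (\<exists>!C. is_cycle V E C)"

definition bipartite :: "'a set \<Rightarrow> 'a set set \<Rightarrow> bool" where
  "bipartite V E \<longleftrightarrow>
     (\<exists>A B. A \<union> B = V \<and> A \<inter> B = {} \<and> (\<forall>e\<in>E. \<exists>a\<in>A. \<exists>b\<in>B. e = {a, b}))"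

definition perfect_matching :: "'a set \<Rightarrow> 'a set set \<Rightarrow> 'a set set \<Rightarrow> bool" where
  "perfect_matching V E M \<longleftrightarrow> M \<subseteq> E \<and> (\<forall>v\<in>V. \<exists>!e. e \<in> M \<and> v \<in> e)"

definition unique_perfect_matching :: "'a set \<Rightarrow> 'a set set \<Rightarrow> 'a set set \<Rightarrow> bool" where
  "unique_perfect_matching V E M \<longleftrightarrow>
     perfect_matching V E M \<and> (\<forall>M'. perfect_matching V E M' \<longrightarrow> M' = M)"

definition pegs :: "'a set set \<Rightarrow> 'a set set \<Rightarrow> 'a set set" where
  "pegs M C = {e \<in> M. e \<notin> C \<and> e \<inter> \<Union>C \<noteq> {}}"

definition co_augmenting_path ::
    "'a set \<Rightarrow> 'a set set \<Rightarrow> 'a set set \<Rightarrow> 'a \<Rightarrow> 'a list \<Rightarrow> 'a \<Rightarrow> bool" where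
  "co_augmenting_path V E M u p v \<longleftrightarrow>
     is_path V E u p v \<and> path_edges p \<noteq> [] \<and>
     hd (path_edges p) \<in> M \<and> last (path_edges p) \<in> M \<and>
     successively (\<lambda>e f. e \<in> M \<longleftrightarrow> f \<notin> M) (path_edges p)"

end

theory Submission
  imports Defs
begin

text \<open>Two distinct paths from \<open>u\<close> to \<open>v\<close> separate at a vertex \<open>a\<close> and first meet again at a
  vertex \<open>b\<close>; the two segments between \<open>a\<close> and \<open>b\<close> form a cycle, which must be the unique one.
  A co-augmenting path contains the matching edge of each of its vertices. So a vertex of the
  cycle other than \<open>a\<close> and \<open>b\<close>, being interior to one of the segments, has its matching edge on
  the cycle. Hence every peg is the matching edge of \<open>a\<close> or of \<open>b\<close>, and there are at most two.\<close>

lemma path_edges_simps [simp]: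
  "path_edges [] = []"
  "path_edges [x] = []"
  "path_edges (x # y # zs) = {x, y} # path_edges (y # zs)"
  by (simp_all add: path_edges_def)

text \<open>The splitting vertex \<open>a\<close> is kept on both sides so that no edge is lost at
  the cut.\<close>

lemma path_edges_append:
  "path_edges (xs @ a # ys) = path_edges (xs @ [a]) @ path_edges (a # ys)"
  by (induction xs rule: induct_list012) auto

lemma path_edges_snoc: "p \<noteq> [] \<Longrightarrow> path_edges (p @ [x]) = path_edges p @ [{last p, x}]"
  by (induction p rule: induct_list012) auto

lemma path_edges_subset: "e \<in> set (path_edges p) \<Longrightarrow> e \<subseteq> set p"
  by (induction p rule: induct_list012) auto

lemma path_edges_rev: "path_edges (rev p) = rev (path_edges p)"
proof (induction p rule: induct_list012)
  case (3 x y zs)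
  have "path_edges (rev (x # y # zs)) = path_edges (rev zs @ [y]) @ path_edges [y, x]"
    using path_edges_append[of "rev zs" y "[x]"] by simp
  then show ?case using 3 by (simp add: insert_commute)
qed auto

text \<open>If the edge leading into \<open>w\<close> is not in \<open>M\<close>, it is not the last
  one, and by alternation the next edge is in \<open>M\<close>. The first edge is left
  unconstrained, since membership of the first edge in \<open>M\<close> would not survive the
  passage to the tail in the induction.\<close>

lemma alternating_covers_tl:
  assumes "path_edges p \<noteq> []" and "last (path_edges p) \<in> M"
    and "successively (\<lambda>e f. e \<in> M \<longleftrightarrow> f \<notin> M) (path_edges p)"
    and "w \<in> set (tl p)"
  shows "\<exists>e\<in>set (path_edges p). e \<in> M \<and> w \<in> e"
  using assms
proof (induction p rule: induct_list012)
  case (3 x y zs)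
  show ?case
  proof (cases zs)
    case Nil
    then show ?thesis using 3 by auto
  next
    case (Cons z zs')
    then show ?thesis using 3 by (cases "w = y") auto
  qed
qed auto

lemma co_augmenting_path_covers:
  assumes "co_augmenting_path V E M u p v" and "w \<in> set p"
  shows "\<exists>e\<in>set (path_edges p). e \<in> M \<and> w \<in> e"
proof (cases "w \<in> set (tl p)")
  case True
  then show ?thesis
    using assms alternating_covers_tl[of p M w] by (auto simp: co_augmenting_path_def)
next
  case False
  then show ?thesis
    \<comment> \<open>Here \<open>w\<close> is the head of \<open>p\<close>, covered by the first
      edge. The borrowed rule separates lists of length 0, 1 and at least 2, as the equations for
      \<open>path_edges\<close> do.\<close>
    using assms by (cases p rule: remdups_adj.cases) (auto simp: co_augmenting_path_def)
qed

text \<open>The matching edge at \<open>w\<close> cannot lie on the outer pieces of the path,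
  because by distinctness these do not visit \<open>w\<close>.\<close>

lemma co_augmenting_path_covers_interior:
  assumes co: "co_augmenting_path V E M u (r @ a # s @ b # t) v" and w: "w \<in> set s"
  shows "\<exists>e\<in>set (path_edges (a # s @ [b])). e \<in> M \<and> w \<in> e"
proof -
  have split: "path_edges (r @ a # s @ b # t) =
      path_edges (r @ [a]) @ path_edges (a # s @ [b]) @ path_edges (b # t)"
    using path_edges_append[of r a "s @ b # t"] path_edges_append[of "a # s" b t] by simp
  obtain e where e: "e \<in> set (path_edges (r @ a # s @ b # t))" "e \<in> M" "w \<in> e"
    using co_augmenting_path_covers[OF co] w by auto
  have "distinct (r @ a # s @ b # t)"
    using co by (simp add: co_augmenting_path_def is_path_def)
  with w have "w \<notin> set (r @ [a])" "w \<notin> set (b # t)"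
    by auto
  with e(3) have "e \<notin> set (path_edges (r @ [a]))" "e \<notin> set (path_edges (b # t))"
    using path_edges_subset by blast+
  with e show ?thesis
    unfolding split by auto
qed

lemma diverging_lists:
  assumes "p \<noteq> q" and "p \<noteq> []" and "q \<noteq> []" and "hd p = hd q" and "last p = last q"
    and "distinct p" and "distinct q"
  obtains r a p1 b p2 q1 q2 where "p = r @ a # p1 @ b # p2" and "q = r @ a # q1 @ b # q2"
    and "set p1 \<inter> set q1 = {}" and "p1 \<noteq> [] \<or> q1 \<noteq> []"
  using assms
proof (induction p arbitrary: q thesis)
  case Nil
  then show ?case by simp
next
  case (Cons x xs)
  obtain ys where q: "q = x # ys"
    using Cons.prems by (cases q) auto
  \<comment> \<open>If just one tail were empty, the other list would start and end in
    \<open>x\<close>, against distinctness.\<close>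
  have ne: "xs \<noteq> []" "ys \<noteq> []"
    using Cons.prems q by (auto split: if_splits)
  have last: "last xs = last ys"
    using Cons.prems q ne by simp
  show ?case
  proof (cases "hd xs = hd ys")
    case True
    show ?thesis
    proof (rule Cons.IH[of ys])
      fix r a p1 b p2 q1 q2
      assume "xs = r @ a # p1 @ b # p2" "ys = r @ a # q1 @ b # q2"
        "set p1 \<inter> set q1 = {}" "p1 \<noteq> [] \<or> q1 \<noteq> []"
      then show thesis
        using Cons.prems(1)[of "x # r" a p1 b p2 q1 q2] q by simp
    qed (use Cons.prems q ne last True in auto)
  next
    case False
    \<comment> \<open>The lists part right after \<open>x\<close>, which becomes \<open>a\<close>.
      The common last entry ensures that they meet again.\<close>
    have "\<exists>b\<in>set xs. b \<in> set ys"
      using ne last by (metis last_in_set)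
    then obtain p1 b p2 where p1: "xs = p1 @ b # p2" "b \<in> set ys" "\<forall>y\<in>set p1. y \<notin> set ys"
      using split_list_first_prop[of xs "\<lambda>b. b \<in> set ys"] by blast
    then obtain q1 q2 where q1: "ys = q1 @ b # q2"
      by (meson split_list)
    \<comment> \<open>\<open>p1\<close> avoids all of \<open>ys\<close>, hence \<open>q1\<close>.
      Were \<open>p1\<close> and \<open>q1\<close> both empty, both tails would start with
      \<open>b\<close>.\<close>
    show ?thesis
      by (rule Cons.prems(1)[of "[]" x p1 b p2 q1 q2]) (use p1 q1 q False in auto)
  qed
qed

lemma is_cycle_of_two_paths:
  assumes "is_path V E u (r @ a # p1 @ b # p2) v" and "is_path V E u (r @ a # q1 @ b # q2) v"
    and "set p1 \<inter> set q1 = {}" and "p1 \<noteq> [] \<or> q1 \<noteq> []"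
  shows "is_cycle V E (set (path_edges (a # p1 @ [b])) \<union> set (path_edges (a # q1 @ [b])))"
proof -
  let ?R = "\<lambda>x y. {x, y} \<in> E"
  \<comment> \<open>Go along the first segment to \<open>b\<close> and back along the second,
    stopping before \<open>a\<close>; the edge back to \<open>a\<close> closes the cycle.\<close>
  define w where "w = a # p1 @ b # rev q1"
  have segment: "successively ?R ys" if "successively ?R (xs @ ys @ zs)" for xs ys zs
    using that by (simp add: successively_append_iff)
  have P: "successively ?R (a # p1 @ [b])"
    using segment[of r "a # p1 @ [b]" p2] assms(1) by (simp add: is_path_def)
  have "successively ?R (a # q1 @ [b])"
    using segment[of r "a # q1 @ [b]" q2] assms(2) by (simp add: is_path_def)
  then have Q: "successively ?R (b # rev q1 @ [a])"
    using successively_rev[of ?R "a # q1 @ [b]"] by (simp add: insert_commute)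
  have "successively ?R w"
    using P Q successively_append_iff[of ?R "a # p1" "[b]"]
      successively_append_iff[of ?R "a # p1" "b # rev q1"]
      successively_append_iff[of ?R "b # rev q1" "[a]"]
    by (simp add: w_def)
  moreover have "distinct w" "set w \<subseteq> V"
    using assms by (auto simp: w_def is_path_def)
  ultimately have "is_path V E a w (last w)"
    by (simp add: is_path_def w_def)
  \<comment> \<open>An interior vertex on either side rules out a single edge traversed back and
    forth.\<close>
  moreover have "3 \<le> length w"
    using assms(4) by (cases p1; cases q1) (auto simp: w_def)
  moreover have "{last w, a} \<in> E"
    using Q successively_append_iff[of ?R "b # rev q1" "[a]"] by (simp add: w_def)
  moreover have "insert {last w, a} (set (path_edges w)) =
      set (path_edges (a # p1 @ [b])) \<union> set (path_edges (a # q1 @ [b]))"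
  proof -
    \<comment> \<open>Appending \<open>a\<close> makes the closing edge an ordinary path edge, so
      the closed walk splits at \<open>b\<close> into the two segments.\<close>
    have "path_edges (w @ [a]) = path_edges (a # p1 @ [b]) @ path_edges (rev (a # q1 @ [b]))"
      using path_edges_append[of "a # p1" b "rev q1 @ [a]"] by (simp add: w_def)
    moreover have "path_edges (w @ [a]) = path_edges w @ [{last w, a}]"
      by (rule path_edges_snoc) (simp add: w_def)
    ultimately have "set (path_edges w @ [{last w, a}]) =
        set (path_edges (a # p1 @ [b]) @ rev (path_edges (a # q1 @ [b])))"
      by (simp only: path_edges_rev)
    then show ?thesis by simp
  qed
  ultimately show ?thesis
    unfolding is_cycle_def by metis
qed

lemma matching_edge_unique:
  assumes "perfect_matching V E M" and "x \<in> V" and "e \<in> M" "x \<in> e" "f \<in> M" "x \<in> f"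
  shows "e = f"
  using assms unfolding perfect_matching_def by blast

lemma card_pegs_le_2:
  assumes pm: "perfect_matching V E M"
    and p: "co_augmenting_path V E M u (r @ a # p1 @ b # p2) v"
    and q: "co_augmenting_path V E M u (r @ a # q1 @ b # q2) v"
    and C: "C = set (path_edges (a # p1 @ [b])) \<union> set (path_edges (a # q1 @ [b]))"
  shows "card (pegs M C) \<le> 2"
proof -
  have V: "set (a # b # p1 @ q1) \<subseteq> V"
    using p q by (auto simp: co_augmenting_path_def is_path_def)
  obtain ea where ea: "ea \<in> M" "a \<in> ea"
    using pm V unfolding perfect_matching_def by auto
  obtain eb where eb: "eb \<in> M" "b \<in> eb"
    using pm V unfolding perfect_matching_def by auto
  have "pegs M C \<subseteq> {ea, eb}"
  proof
    fix e assume "e \<in> pegs M C"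
    then obtain x f where e: "e \<in> M" "e \<notin> C" "x \<in> e" "f \<in> C" "x \<in> f"
      by (auto simp: pegs_def)
    then have "x \<in> set (a # b # p1 @ q1)"
      using path_edges_subset[of f "a # p1 @ [b]"] path_edges_subset[of f "a # q1 @ [b]"]
      by (auto simp: C)
    \<comment> \<open>Otherwise some edge of \<open>C\<close> in \<open>M\<close> covers
      \<open>x\<close>; it must be \<open>e\<close>, which is not in \<open>C\<close>.\<close>
    moreover have "x \<notin> set p1"
      using co_augmenting_path_covers_interior[OF p] matching_edge_unique[OF pm] e V C
        calculation by blast
    moreover have "x \<notin> set q1"
      using co_augmenting_path_covers_interior[OF q] matching_edge_unique[OF pm] e V C
        calculation(1) by blast
    ultimately have "x = a \<or> x = b" by auto
    then show "e \<in> {ea, eb}"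
      using matching_edge_unique[OF pm, of x] e V ea eb by auto
  qed
  then have "card (pegs M C) \<le> card {ea, eb}"
    by (intro card_mono) auto
  also have "\<dots> \<le> 2" by (simp add: card_insert_if)
  finally show ?thesis .
qed

theorem theorem10:
  fixes V :: "'a set" and E M C :: "'a set set"
  assumes "simple_graph V E"
    and "unicyclic V E"
    and "bipartite V E"
    and "unique_perfect_matching V E M"
    and "is_cycle V E C"
    and "card (pegs M C) > 2"
  shows "\<forall>u\<in>V. \<forall>v\<in>V. \<exists>\<^sub>\<le>\<^sub>1 p. co_augmenting_path V E M u p v"
proof (intro ballI Uniq_I, rule ccontr)
  fix u v p q
  assume p: "co_augmenting_path V E M u p v" and q: "co_augmenting_path V E M u q v"
    and ne: "p \<noteq> q"
  have paths: "is_path V E u p v" "is_path V E u q v"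
    using p q by (auto simp: co_augmenting_path_def)
  obtain r a p1 b p2 q1 q2 where d: "p = r @ a # p1 @ b # p2" "q = r @ a # q1 @ b # q2"
      "set p1 \<inter> set q1 = {}" "p1 \<noteq> [] \<or> q1 \<noteq> []"
    using paths ne by (elim diverging_lists[of p q]) (simp_all add: is_path_def)
  have "is_cycle V E (set (path_edges (a # p1 @ [b])) \<union> set (path_edges (a # q1 @ [b])))"
    using is_cycle_of_two_paths paths d by metis
  then have "C = set (path_edges (a # p1 @ [b])) \<union> set (path_edges (a # q1 @ [b]))"
    using assms(2,5) unfolding unicyclic_def by blast
  moreover have "perfect_matching V E M"
    using assms(4) by (simp add: unique_perfect_matching_def)
  ultimately have "card (pegs M C) \<le> 2"
    using card_pegs_le_2 p q d by metis
  with assms(6) show False by simp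
qed

end
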